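(* Let $(X,\triangleright)$ be a left shelf and $\varphi:X\to X^X$, $a\mapsto\varphi_a$, a map such that each $\varphi_a$ admits a (unique) relative commuting inverse $\varphi_a^-$ and such that $$\varphi_a^0L_b=L_b\varphi_a^0,\qquad \varphi^0_{\varphi_a(b)}=\varphi^0_a\varphi^0_b,\qquad \varphi^0_{\varphi^0_a(b)}L_{\varphi^0_a(b)}(a)=L_b(a)$$ for all $a,b\in X$. Then the map $r_\varphi:X\times X\to X\times X$ defined by $$r_\varphi(a,b)=\left(\varphi_a(b),\ \varphi^-_{\varphi_a(b)}\left(\varphi_a(b)\triangleright a\right)\right)$$ for all $a,b\in X$ is a quasi left non-degenerate solution satisfying, when written as $r_\varphi(x,y)=(\lambda_x(y),\rho_y(x))$, $$\lambda^0_{\lambda_x(y)}=\lambda^0_x\lambda^0_y,\qquad \rho_y(x)=\lambda^0_{\lambda_x(y)}\rho_{\lambda^0_x(y)}(x),\qquad \lambda^0_x\rho_y=\rho_y\lambda^0_x\qquad (\star)$$ for all $x,y\in X$, if and only if $\varphi$ is a g-twist. Moreover, any quasi left non-degenerate solution $(X,r)$, $r(x,y)=(\lambda_x(y),\rho_y(x))$, satisfying the three identities $(\star)$ for all $x,y\in X$ can be obtained in this way, i.e. $r=r_\varphi$ for some left shelf structure $(X,\triangleright)$ on $X$ and some g-twist $\varphi$ of it.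
   Context: $X^X$ is the monoid of all maps $X\to X$; juxtaposition denotes composition, $(fg)(x)=f(g(x))$. For $f\in X^X$, a relative (commuting) inverse of $f$ is a map $f^-\in X^X$ with $ff^-f=f$, $f^-ff^-=f^-$, $ff^-=f^-f$; it is unique if it exists, and $f^0:=ff^-=f^-f$. A (left) shelf $(X,\triangleright)$ is a set with a binary operation such that $x\triangleright(y\triangleright z)=(x\triangleright y)\triangleright(x\triangleright z)$ for all $x,y,z$; write $L_x(y)=x\triangleright y$. $\mathrm{Hom}(X,\triangleright)$ is the set of shelf homomorphisms from $(X,\triangleright)$ to itself. g-twist: for a shelf $(X,\triangleright)$, a map $\varphi:X\to\mathrm{Hom}(X,\triangleright)$, $a\mapsto\varphi_a$, such that each $\varphi_a$ admits a (unique) relative commuting inverse, the identities $\varphi_a^0L_b=L_b\varphi_a^0$, $\varphi^0_{\varphi_a(b)}=\varphi^0_a\varphi^0_b$, $\varphi^0_{\varphi^0_a(b)}L_{\varphi^0_a(b)}(a)=L_b(a)$ hold for all $a,b\in X$, and $$\varphi_a\varphi_b=\varphi_{\varphi_a(b)}\,\varphi_{\varphi^-_{\varphi_a(b)}L_{\varphi_a(b)}(a)}\qquad\text{for all }a,b\in X.$$ A solution is a pair $(X,r)$ with $r:X\times X\to X\times X$ satisfying $(r\times\mathrm{id}_X)(\mathrm{id}_X\times r)(r\times\mathrm{id}_X)=(\mathrm{id}_X\times r)(r\times\mathrm{id}_X)(\mathrm{id}_X\times r)$; write $r(x,y)=(\lambda_x(y),\rho_y(x))$. It is quasi left non-degenerate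 if every $\lambda_x$ has a (unique) relative inverse $\lambda_x^-$ and $\lambda_x^0\lambda_y=\lambda_y\lambda_x^0$ for all $x,y\in X$.
   Formalization: The right side of the equivalence reads "φ is a g-twist and φ_a^0 φ_b = φ_b φ_a^0 for all a, b", since a g-twist alone need not give quasi left non-degeneracy: take X={0,1}, a▷b=b, φ_a constant with value a. *)

theory Defs
  imports Main
begin

definition is_rel_inverse :: "('a \<Rightarrow> 'a) \<Rightarrow> ('a \<Rightarrow> 'a) \<Rightarrow> bool" where
  "is_rel_inverse f g \<longleftrightarrow> f \<circ> g \<circ> f = f \<and> g \<circ> f \<circ> g = g \<and> f \<circ> g = g \<circ> f"

definition has_rel_inverse :: "('a \<Rightarrow> 'a) \<Rightarrow> bool" where
  "has_rel_inverse f \<longleftrightarrow> (\<exists>g. is_rel_inverse f g)"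

lemma is_rel_inverse_unique:
  assumes "is_rel_inverse f g" "is_rel_inverse f h"
  shows "g = h"
proof -
  have g: "\<And>x. f (g (f x)) = f x" "\<And>x. g (f (g x)) = g x" "\<And>x. f (g x) = g (f x)"
    using assms(1) unfolding is_rel_inverse_def by (metis comp_apply)+
  have h: "\<And>x. f (h (f x)) = f x" "\<And>x. h (f (h x)) = h x" "\<And>x. f (h x) = h (f x)"
    using assms(2) unfolding is_rel_inverse_def by (metis comp_apply)+
  have "g x = h x" for x
    by (metis g h)
  then show ?thesis by blast
qed

text \<open>By uniqueness, \<open>rel_inv f\<close> is the map written \<open>f\<^sup>-\<close> whenever \<open>has_rel_inverse f\<close> holds; it is
  unspecified otherwise.\<close>

definition rel_inv :: "('a \<Rightarrow> 'a) \<Rightarrow> 'a \<Rightarrow> 'a" where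
  "rel_inv f = (THE g. is_rel_inverse f g)"

lemma rel_inv_eqI: "is_rel_inverse f g \<Longrightarrow> rel_inv f = g"
  unfolding rel_inv_def by (blast intro: the_equality is_rel_inverse_unique)

text \<open>The map written \<open>f\<^sup>0\<close>.\<close>

definition rel_idem :: "('a \<Rightarrow> 'a) \<Rightarrow> 'a \<Rightarrow> 'a" where
  "rel_idem f = f \<circ> rel_inv f"

text \<open>A binary operation is a curried function \<open>T\<close> with \<open>T x y = x \<triangleright> y\<close>, so that the left
  multiplication \<open>L\<^sub>x\<close> is the partial application \<open>T x\<close>.\<close>

definition left_shelf :: "('a \<Rightarrow> 'a \<Rightarrow> 'a) \<Rightarrow> bool" where
  "left_shelf T \<longleftrightarrow> (\<forall>x y z. T x (T y z) = T (T x y) (T x z))"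

definition shelf_Hom :: "('a \<Rightarrow> 'a \<Rightarrow> 'a) \<Rightarrow> ('a \<Rightarrow> 'a) set" where
  "shelf_Hom T = {f. \<forall>x y. f (T x y) = T (f x) (f y)}"

definition g_twist :: "('a \<Rightarrow> 'a \<Rightarrow> 'a) \<Rightarrow> ('a \<Rightarrow> 'a \<Rightarrow> 'a) \<Rightarrow> bool" where
  "g_twist T \<phi> \<longleftrightarrow>
     (\<forall>a. \<phi> a \<in> shelf_Hom T) \<and>
     (\<forall>a. has_rel_inverse (\<phi> a)) \<and>
     (\<forall>a b. rel_idem (\<phi> a) \<circ> T b = T b \<circ> rel_idem (\<phi> a)) \<and>
     (\<forall>a b. rel_idem (\<phi> (\<phi> a b)) = rel_idem (\<phi> a) \<circ> rel_idem (\<phi> b)) \<and>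
     (\<forall>a b. rel_idem (\<phi> (rel_idem (\<phi> a) b)) (T (rel_idem (\<phi> a) b) a) = T b a) \<and>
     (\<forall>a b. \<phi> a \<circ> \<phi> b = \<phi> (\<phi> a b) \<circ> \<phi> (rel_inv (\<phi> (\<phi> a b)) (T (\<phi> a b) a)))"

definition r12 :: "('a \<times> 'a \<Rightarrow> 'a \<times> 'a) \<Rightarrow> 'a \<times> 'a \<times> 'a \<Rightarrow> 'a \<times> 'a \<times> 'a" where
  "r12 r = (\<lambda>(x, y, z). let (u, v) = r (x, y) in (u, v, z))"

definition r23 :: "('a \<times> 'a \<Rightarrow> 'a \<times> 'a) \<Rightarrow> 'a \<times> 'a \<times> 'a \<Rightarrow> 'a \<times> 'a \<times> 'a" where
  "r23 r = (\<lambda>(x, y, z). (x, r (y, z)))"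

definition solution :: "('a \<times> 'a \<Rightarrow> 'a \<times> 'a) \<Rightarrow> bool" where
  "solution r \<longleftrightarrow> r12 r \<circ> r23 r \<circ> r12 r = r23 r \<circ> r12 r \<circ> r23 r"

text \<open>\<open>r (x, y) = (lam r x y, rho r y x)\<close>; note the order of the arguments of \<open>rho\<close>.\<close>

definition lam :: "('a \<times> 'a \<Rightarrow> 'a \<times> 'a) \<Rightarrow> 'a \<Rightarrow> 'a \<Rightarrow> 'a" where
  "lam r x y = fst (r (x, y))"

definition rho :: "('a \<times> 'a \<Rightarrow> 'a \<times> 'a) \<Rightarrow> 'a \<Rightarrow> 'a \<Rightarrow> 'a" where
  "rho r y x = snd (r (x, y))"

definition quasi_left_nondegenerate :: "('a \<times> 'a \<Rightarrow> 'a \<times> 'a) \<Rightarrow> bool" where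
  "quasi_left_nondegenerate r \<longleftrightarrow>
     (\<forall>x. has_rel_inverse (lam r x)) \<and>
     (\<forall>x y. rel_idem (lam r x) \<circ> lam r y = lam r y \<circ> rel_idem (lam r x))"

definition star_identities :: "('a \<times> 'a \<Rightarrow> 'a \<times> 'a) \<Rightarrow> bool" where
  "star_identities r \<longleftrightarrow> (\<forall>x y.
     rel_idem (lam r (lam r x y)) = rel_idem (lam r x) \<circ> rel_idem (lam r y) \<and>
     rho r y x = rel_idem (lam r (lam r x y)) (rho r (rel_idem (lam r x) y) x) \<and>
     rel_idem (lam r x) \<circ> rho r y = rho r y \<circ> rel_idem (lam r x))"

definition r_of :: "('a \<Rightarrow> 'a \<Rightarrow> 'a) \<Rightarrow> ('a \<Rightarrow> 'a \<Rightarrow> 'a) \<Rightarrow> 'a \<times> 'a \<Rightarrow> 'a \<times> 'a" where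
  "r_of T \<phi> = (\<lambda>(a, b). (\<phi> a b, rel_inv (\<phi> (\<phi> a b)) (T (\<phi> a b) a)))"

text \<open>A g-twist need not satisfy \<open>\<phi>\<^sub>a\<^sup>0 \<phi>\<^sub>b = \<phi>\<^sub>b \<phi>\<^sub>a\<^sup>0\<close>, although this is part of
  \<open>quasi_left_nondegenerate (r_of T \<phi>)\<close>, whose \<open>\<lambda>\<^sub>a\<close> is \<open>\<phi>\<^sub>a\<close>. On a two-element set with
  \<open>a \<triangleright> b = b\<close>, the constant maps \<open>\<phi>\<^sub>a = (\<lambda>_. a)\<close> form a g-twist for which it fails. So
  being a g-twist does not by itself imply quasi left non-degeneracy.\<close>

lemma g_twist_not_quasi_left_nondegenerate:
  defines "T \<equiv> (\<lambda>a b :: bool. b)" and "\<phi> \<equiv> (\<lambda>a b :: bool. a)"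
  shows "left_shelf T" "g_twist T \<phi>" "\<not> quasi_left_nondegenerate (r_of T \<phi>)"
proof -
  have ri: "is_rel_inverse (\<lambda>_. a) (\<lambda>_. a)" for a :: bool
    by (simp add: is_rel_inverse_def fun_eq_iff)
  have inv: "rel_inv (\<lambda>_. a) = (\<lambda>_. a)" for a :: bool
    using ri by (rule rel_inv_eqI)
  have idem: "rel_idem (\<lambda>_. a) = (\<lambda>_. a)" for a :: bool
    by (simp add: rel_idem_def inv fun_eq_iff)
  have has: "has_rel_inverse (\<lambda>_. a)" for a :: bool
    using ri by (auto simp: has_rel_inverse_def)
  show "left_shelf T" by (simp add: left_shelf_def T_def)
  show "g_twist T \<phi>"
    by (simp add: g_twist_def T_def \<phi>_def shelf_Hom_def has inv idem fun_eq_iff)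
  have "lam (r_of T \<phi>) = (\<lambda>a _. a)"
    by (simp add: lam_def r_of_def \<phi>_def fun_eq_iff)
  then show "\<not> quasi_left_nondegenerate (r_of T \<phi>)"
    by (simp add: quasi_left_nondegenerate_def idem) (metis (full_types) comp_apply)
qed

end

theory Submission
  imports Defs
begin

text \<open>
  Write \<open>\<psi> a\<close> and \<open>\<epsilon> a\<close> for the relative inverse and the idempotent of \<open>\<phi> a\<close>. The braid equation
  for \<open>r (x, y) = (\<phi> x y, \<rho> y x)\<close> splits into three coordinate equations. Assume the identities on
  idempotents and that every \<open>\<epsilon> a\<close> commutes with every \<open>\<phi> b\<close>; the latter is part of quasi left
  non-degeneracy of \<open>r_of T \<phi>\<close>, so it may be assumed on both sides of the equivalence. Then each
  coordinate carries one part of the structure: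

  \<^item> the first coordinate is the product formula of a g-twist,
  \<^item> given the first, the middle one says that every \<open>\<phi> x\<close> is a shelf homomorphism
    (\<open>middle_braid_iff_hom\<close>),
  \<^item> given the first two, the last one says that \<open>T\<close> is left self-distributive
    (\<open>last_braid_iff_shelf\<close>).

  If all \<open>\<phi> x\<close> were bijective, so that every \<open>\<epsilon> a\<close> is the identity, this would be a direct
  computation: writing \<open>\<rho> b a\<close> as \<open>\<psi> u (T u a)\<close> with \<open>u = \<phi> a b\<close>, the product formula moves all
  inverses to the front of both sides of each equation, where they cancel. In general a relative
  inverse cancels only up to an idempotent, and the idempotents have to be seen not to matter. They
  commute with one another and with all maps \<open>\<phi> b\<close>, \<open>\<psi> b\<close> and \<open>T b\<close>, and the value \<open>T b a\<close> is fixed by both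
  \<open>\<epsilon> a\<close> and \<open>\<epsilon> b\<close> and does not change when \<open>b\<close> is replaced by \<open>\<epsilon> a b\<close>. So an idempotent
  left over by a cancellation can be absorbed, and an argument of \<open>T\<close> can be projected so as to lie
  in the image of a given \<open>\<phi> x\<close>.

  The third star identity needs one more fact: the product formula forces
  \<open>\<phi> (\<epsilon> x b) = \<epsilon> x \<circ> \<phi> b\<close> (\<open>phi_of_idem\<close>). The same fact is used for the converse construction,
  where \<open>T\<close> is recovered from a solution by solving \<open>\<rho> b a = \<psi> u (T u a)\<close> for \<open>T\<close>. Once this \<open>T\<close>
  is known to satisfy the identities on idempotents, the equivalences above applied to \<open>r = r_of T \<phi>\<close>
  give both the shelf property and the g-twist.
\<close>

section \<open>Relative inverses and the braid equation\<close>

lemma rel_inv_is_rel_inverse: "has_rel_inverse f \<Longrightarrow> is_rel_inverse f (rel_inv f)"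
  unfolding has_rel_inverse_def using rel_inv_eqI by metis

lemma solution_iff_braid_equations:
  "solution r \<longleftrightarrow>
     (\<forall>x y z. lam r x (lam r y z) = lam r (lam r x y) (lam r (rho r y x) z)) \<and>
     (\<forall>x y z. rho r (lam r (rho r y x) z) (lam r x y) = lam r (rho r (lam r y z) x) (rho r z y)) \<and>
     (\<forall>x y z. rho r z (rho r y x) = rho r (rho r z y) (rho r (lam r y z) x))"
proof -
  have r: "r p = (lam r (fst p) (snd p), rho r (snd p) (fst p))" for p
    by (simp add: lam_def rho_def)
  have r12: "r12 r (x, y, z) = (lam r x y, rho r y x, z)" for x y z
    by (simp add: r12_def r[of "(x, y)"])
  have r23: "r23 r (x, y, z) = (x, lam r y z, rho r z y)" for x y z
    by (simp add: r23_def r[of "(y, z)"])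
  show ?thesis
    unfolding solution_def fun_eq_iff by (auto simp: r12 r23)
qed

text \<open>The relative inverse is the group inverse of \<open>f\<close> in the monoid of maps, and a group inverse
  commutes with everything that commutes with \<open>f\<close>: first this is seen for the idempotent, and then
  the inverse is reached by cancelling \<open>f\<close> on its image.\<close>

lemma rel_inv_commute:
  assumes f: "has_rel_inverse f" and e: "\<And>x. e (f x) = f (e x)"
  shows "e (rel_inv f x) = rel_inv f (e x)"
proof -
  let ?g = "rel_inv f"
  have g: "f (?g (f y)) = f y" "?g (f (?g y)) = ?g y" "f (?g y) = ?g (f y)" for y
    using rel_inv_is_rel_inverse[OF f] unfolding is_rel_inverse_def by (metis comp_apply)+
  \<comment> \<open>Write \<open>p\<close> for the idempotent \<open>f g = g f\<close>. Both \<open>p e\<close> and \<open>e p\<close> equal \<open>p e p\<close>.\<close>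
  have 1: "?g (f (e y)) = ?g (f (e (?g (f y))))" for y
    by (metis e g)
  have 2: "e (f (?g y)) = ?g (f (e (?g (f y))))" for y
    by (metis e g)
  have comm: "e (f (?g y)) = ?g (f (e y))" for y
    by (rule trans[OF 2 1[symmetric]])
  show ?thesis
    by (metis comm e g)
qed

section \<open>Families of maps with commuting idempotents\<close>

text \<open>The left actions of a quasi left non-degenerate solution with the star identities have these
  properties before any shelf operation is constructed.\<close>

locale idempotent_family =
  fixes \<phi> :: "'a \<Rightarrow> 'a \<Rightarrow> 'a"
  assumes has_inv: "has_rel_inverse (\<phi> a)"
    and idem_comm: "rel_idem (\<phi> a) (\<phi> b x) = \<phi> b (rel_idem (\<phi> a) x)"
    and idem_phi: "rel_idem (\<phi> (\<phi> a b)) x = rel_idem (\<phi> a) (rel_idem (\<phi> b) x)"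
begin

abbreviation \<psi> :: "'a \<Rightarrow> 'a \<Rightarrow> 'a" where "\<psi> a \<equiv> rel_inv (\<phi> a)"
abbreviation \<epsilon> :: "'a \<Rightarrow> 'a \<Rightarrow> 'a" where "\<epsilon> a \<equiv> rel_idem (\<phi> a)"

lemma phi_psi: "\<phi> a (\<psi> a x) = \<epsilon> a x"
  by (simp add: rel_idem_def)

lemma psi_phi: "\<psi> a (\<phi> a x) = \<epsilon> a x"
  using rel_inv_is_rel_inverse[OF has_inv, of a] unfolding is_rel_inverse_def rel_idem_def
  by (metis comp_apply)

lemma idem_phi_self: "\<epsilon> a (\<phi> a x) = \<phi> a x"
  using rel_inv_is_rel_inverse[OF has_inv, of a] unfolding is_rel_inverse_def rel_idem_def
  by (metis comp_apply)

lemma idem_psi_self: "\<epsilon> a (\<psi> a x) = \<psi> a x"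
  using rel_inv_is_rel_inverse[OF has_inv, of a] unfolding is_rel_inverse_def rel_idem_def
  by (metis comp_apply)

lemma idem_idem: "\<epsilon> a (\<epsilon> a x) = \<epsilon> a x"
  by (metis phi_psi idem_phi_self)

lemma phi_idem: "\<phi> a (\<epsilon> a x) = \<phi> a x"
  by (metis idem_comm idem_phi_self)

lemma idem_psi: "\<epsilon> a (\<psi> b x) = \<psi> b (\<epsilon> a x)"
  using rel_inv_commute[OF has_inv, of "\<epsilon> a" b] idem_comm by metis

lemma psi_idem: "\<psi> a (\<epsilon> a x) = \<psi> a x"
  by (metis idem_psi idem_psi_self)

lemma idem_commute: "\<epsilon> a (\<epsilon> b x) = \<epsilon> b (\<epsilon> a x)"
  by (metis phi_psi idem_comm idem_psi)

lemma idem_of_idem: "\<epsilon> (\<epsilon> a b) x = \<epsilon> a (\<epsilon> b x)"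
  by (metis phi_psi phi_idem idem_idem idem_phi)

lemma idem_of_psi: "\<epsilon> (\<psi> a b) x = \<epsilon> a (\<epsilon> b x)"
  by (metis phi_psi idem_phi idem_psi_self idem_of_idem)

text \<open>An element of the image of \<open>\<epsilon> a\<close> indexes an idempotent below \<open>\<epsilon> a\<close>, because
  \<open>\<epsilon> (\<epsilon> a b) = \<epsilon> a \<circ> \<epsilon> b\<close>. Most idempotents that arise from cancellation are removed this
  way.\<close>

lemma idem_absorb: "\<epsilon> a b = b \<Longrightarrow> \<epsilon> a (\<epsilon> b x) = \<epsilon> b x"
  by (metis idem_of_idem)

text \<open>The right-hand side of the product formula depends on \<open>y\<close> only through \<open>\<phi> x y\<close> and
  \<open>\<rho> y x\<close>, neither of which sees the replacement of \<open>y\<close> by \<open>\<epsilon> x y\<close>. Hence \<open>\<phi> b\<close> and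
  \<open>\<phi> (\<epsilon> x b)\<close> agree after composing with \<open>\<phi> x\<close>, that is, after projecting by \<open>\<epsilon> x\<close>, and the
  values of \<open>\<phi> (\<epsilon> x b)\<close> are already projected.\<close>

lemma phi_of_idem:
  assumes braid: "\<And>x y z. \<phi> x (\<phi> y z) = \<phi> (\<phi> x y) (\<phi> (\<rho> y x) z)"
    and rho: "\<And>x y. \<rho> (\<epsilon> x y) x = \<rho> y x"
  shows "\<phi> (\<epsilon> x b) z = \<epsilon> x (\<phi> b z)"
proof -
  have "\<phi> x (\<phi> b z) = \<phi> x (\<phi> (\<epsilon> x b) z)"
    by (metis braid rho phi_idem)
  then have "\<epsilon> x (\<phi> b z) = \<epsilon> x (\<phi> (\<epsilon> x b) z)"
    by (metis psi_phi)
  also have "\<dots> = \<phi> (\<epsilon> x b) z"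
    by (metis idem_phi_self idem_absorb idem_idem)
  finally show ?thesis by simp
qed

lemma psi_of_idem:
  assumes "\<And>z. \<phi> (\<epsilon> x b) z = \<epsilon> x (\<phi> b z)"
  shows "\<psi> (\<epsilon> x b) z = \<epsilon> x (\<psi> b z)"
proof -
  have "is_rel_inverse (\<phi> (\<epsilon> x b)) (\<lambda>z. \<epsilon> x (\<psi> b z))"
    by (simp add: is_rel_inverse_def fun_eq_iff assms flip: idem_comm idem_psi)
      (simp add: idem_idem idem_comm idem_psi phi_psi psi_phi phi_idem psi_idem idem_commute)
  then show ?thesis by (simp add: rel_inv_eqI)
qed

end

section \<open>Compatibility of the idempotents with a binary operation\<close>

text \<open>Self-distributivity of \<open>T\<close> is not among these properties, since it is to be characterized by
  one of the coordinates of the braid equation.\<close>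

locale shelf_twist = idempotent_family \<phi> for \<phi> :: "'a \<Rightarrow> 'a \<Rightarrow> 'a" +
  fixes T :: "'a \<Rightarrow> 'a \<Rightarrow> 'a"
  assumes idem_T: "rel_idem (\<phi> a) (T b x) = T b (rel_idem (\<phi> a) x)"
    and T_idem: "rel_idem (\<phi> (rel_idem (\<phi> a) b)) (T (rel_idem (\<phi> a) b) a) = T b a"
begin

definition \<rho> :: "'a \<Rightarrow> 'a \<Rightarrow> 'a" where
  "\<rho> b a = \<psi> (\<phi> a b) (T (\<phi> a b) a)"

lemma idem_left_T: "\<epsilon> b (T b a) = T b a"
  by (metis T_idem idem_of_idem idem_idem idem_commute)

lemma idem_right_T: "\<epsilon> a (T b a) = T b a"
  by (metis T_idem idem_of_idem idem_idem)

lemma T_idem_right: "T (\<epsilon> a b) a = T b a"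
  by (metis T_idem idem_left_T)

text \<open>Since \<open>T b a\<close> sees \<open>b\<close> only through \<open>\<epsilon> a b\<close>, it is also insensitive to any idempotent
  above \<open>\<epsilon> a\<close>.\<close>

lemma T_idem_left_arg: "\<epsilon> x a = a \<Longrightarrow> T (\<epsilon> x b) a = T b a"
  by (metis T_idem_right idem_of_idem idem_idem idem_commute)

lemma idem_T_idem_left_arg: "\<epsilon> x (T (\<epsilon> x b) a) = \<epsilon> x (T b a)"
  by (metis T_idem_left_arg idem_T idem_idem)

lemma idem_rho: "\<epsilon> (\<phi> a b) (\<rho> b a) = \<rho> b a"
  by (simp add: \<rho>_def idem_psi_self)

lemma rho_idem: "\<rho> (\<epsilon> a b) a = \<rho> b a"
  by (simp add: \<rho>_def phi_idem)

end

section \<open>Consequences of the product formula\<close>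

locale braided_shelf_twist = shelf_twist +
  assumes braid: "\<phi> x (\<phi> y z) = \<phi> (\<phi> x y) (\<phi> (\<rho> y x) z)"
begin

lemmas phi_idem_arg = phi_of_idem[where \<rho> = \<rho>, OF braid rho_idem]
lemmas psi_idem_arg = psi_of_idem[OF phi_idem_arg]

text \<open>Moving \<open>\<epsilon> x\<close> into the second argument \<open>a\<close> of \<open>\<rho> y a\<close> also changes the two occurrences of
  \<open>\<phi> a y\<close>; by \<open>phi_idem_arg\<close> each change is a projection by \<open>\<epsilon> x\<close>, which is absorbed.\<close>

lemma idem_rho_commute: "\<epsilon> x (\<rho> y a) = \<rho> y (\<epsilon> x a)"
proof -
  have "\<rho> y (\<epsilon> x a) = \<epsilon> x (\<psi> (\<phi> a y) (\<epsilon> x (T (\<epsilon> x (\<phi> a y)) a)))"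
    by (simp add: \<rho>_def phi_idem_arg psi_idem_arg idem_T)
  also have "\<dots> = \<epsilon> x (\<rho> y a)"
    by (simp add: idem_T_idem_left_arg \<rho>_def flip: idem_psi) (simp add: idem_idem)
  finally show ?thesis by simp
qed

text \<open>This is the product formula \<open>\<phi> x (\<phi> c z) = \<phi> (\<phi> x c) (\<phi> (\<rho> c x) z)\<close> solved for
  \<open>\<phi> (\<rho> c x)\<close>, with \<open>z = \<psi> c s\<close>.\<close>

lemma phi_rho_psi: "\<phi> (\<rho> c x) (\<psi> c s) = \<psi> (\<phi> x c) (\<phi> x (\<epsilon> c s))"
proof -
  have "\<psi> (\<phi> x c) (\<phi> x (\<epsilon> c s)) = \<epsilon> (\<phi> x c) (\<phi> (\<rho> c x) (\<psi> c s))"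
    by (metis phi_psi psi_phi braid)
  also have "\<dots> = \<phi> (\<rho> c x) (\<psi> c s)"
    by (metis idem_rho idem_absorb idem_phi_self)
  finally show ?thesis by simp
qed

lemma rho_middle: "\<rho> (\<phi> (\<rho> y x) z) (\<phi> x y) = \<psi> (\<phi> x (\<phi> y z)) (T (\<phi> x (\<phi> y z)) (\<phi> x y))"
  by (simp add: \<rho>_def[of _ "\<phi> x y"] flip: braid)

lemma phi_rho_rho: "\<phi> (\<rho> (\<phi> y z) x) (\<rho> z y) = \<psi> (\<phi> x (\<phi> y z)) (\<phi> x (T (\<phi> y z) y))"
  unfolding \<rho>_def[of z y] phi_rho_psi by (simp add: idem_left_T)

text \<open>Both sides of the middle equation are \<open>\<psi> u\<close> applied to something fixed by \<open>\<epsilon> u\<close>, where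
  \<open>u = \<phi> x (\<phi> y z)\<close>, and \<open>\<psi> u\<close> is injective on the fixed points of \<open>\<epsilon> u\<close>.\<close>

lemma middle_braid_iff:
  "\<rho> (\<phi> (\<rho> y x) z) (\<phi> x y) = \<phi> (\<rho> (\<phi> y z) x) (\<rho> z y) \<longleftrightarrow>
   T (\<phi> x (\<phi> y z)) (\<phi> x y) = \<phi> x (T (\<phi> y z) y)"
proof -
  let ?u = "\<phi> x (\<phi> y z)"
  have "\<epsilon> ?u (T ?u (\<phi> x y)) = T ?u (\<phi> x y)"
    by (rule idem_left_T)
  moreover have "\<epsilon> ?u (\<phi> x (T (\<phi> y z) y)) = \<phi> x (T (\<phi> y z) y)"
    by (metis idem_phi idem_comm idem_left_T idem_phi_self)
  ultimately show ?thesis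
    unfolding rho_middle phi_rho_rho by (metis phi_psi)
qed

text \<open>The pointwise equivalence gives the homomorphism law for \<open>T c y\<close> with \<open>c\<close> in the image of
  \<open>\<phi> y\<close>. This suffices because \<open>T c y = T (\<epsilon> y c) y\<close>.\<close>

lemma middle_braid_iff_hom:
  "(\<forall>x y z. \<rho> (\<phi> (\<rho> y x) z) (\<phi> x y) = \<phi> (\<rho> (\<phi> y z) x) (\<rho> z y)) \<longleftrightarrow>
   (\<forall>x. \<phi> x \<in> shelf_Hom T)"
proof
  assume "\<forall>x y z. \<rho> (\<phi> (\<rho> y x) z) (\<phi> x y) = \<phi> (\<rho> (\<phi> y z) x) (\<rho> z y)"
  then have *: "T (\<phi> x (\<phi> y z)) (\<phi> x y) = \<phi> x (T (\<phi> y z) y)" for x y z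
    by (simp only: middle_braid_iff)
  have "\<phi> x (T c y) = T (\<phi> x c) (\<phi> x y)" for x c y
  proof -
    have "\<phi> x (T c y) = T (\<phi> x (\<epsilon> y c)) (\<phi> x y)"
      by (metis * phi_psi T_idem_right)
    also have "\<phi> x (\<epsilon> y c) = \<epsilon> (\<phi> x y) (\<phi> x c)"
      by (metis idem_phi idem_comm idem_phi_self)
    finally show ?thesis by (simp add: T_idem_right)
  qed
  then show "\<forall>x. \<phi> x \<in> shelf_Hom T" by (simp add: shelf_Hom_def)
next
  assume "\<forall>x. \<phi> x \<in> shelf_Hom T"
  then show "\<forall>x y z. \<rho> (\<phi> (\<rho> y x) z) (\<phi> x y) = \<phi> (\<rho> (\<phi> y z) x) (\<rho> z y)"
    by (simp add: middle_braid_iff shelf_Hom_def)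
qed

text \<open>The product formula writes one map \<open>M\<close> as \<open>\<phi> d \<circ> \<phi> w\<close> and as \<open>\<phi> u \<circ> \<phi> v\<close>. The inverses
  of the factors, composed in the opposite order, give a relative inverse of \<open>M\<close> in both cases,
  because in each case the outer idempotent absorbs the inner one; so the two agree by uniqueness.\<close>

lemma psi_psi_eq:
  assumes "\<epsilon> d w = w"
  shows "\<psi> w (\<psi> d s) = \<psi> (\<rho> w d) (\<psi> (\<phi> d w) s)"
proof -
  let ?u = "\<phi> d w" and ?v = "\<rho> w d"
  let ?M = "\<lambda>s. \<phi> d (\<phi> w s)"
  have M: "?M s = \<phi> ?u (\<phi> ?v s)" for s
    by (rule braid)
  have dw: "\<epsilon> d (\<epsilon> w s) = \<epsilon> w s" for s
    using assms by (rule idem_absorb)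
  have uv: "\<epsilon> ?u (\<epsilon> ?v s) = \<epsilon> ?v s" for s
    using idem_rho by (rule idem_absorb)
  have 1: "\<phi> d (\<phi> w (\<psi> w (\<psi> d s))) = \<epsilon> w s" "\<psi> w (\<psi> d (\<phi> d (\<phi> w s))) = \<epsilon> w s" for s
    by (metis dw phi_psi psi_phi idem_comm idem_psi idem_commute)+
  have 2: "\<phi> ?u (\<phi> ?v (\<psi> ?v (\<psi> ?u s))) = \<epsilon> ?v s" "\<psi> ?v (\<psi> ?u (\<phi> ?u (\<phi> ?v s))) = \<epsilon> ?v s" for s
    by (metis uv phi_psi psi_phi idem_comm idem_psi idem_commute)+
  have "is_rel_inverse ?M (\<lambda>s. \<psi> w (\<psi> d s))"
    unfolding is_rel_inverse_def fun_eq_iff comp_apply 1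
    by (metis idem_comm idem_phi_self idem_psi idem_psi_self)
  moreover have "is_rel_inverse ?M (\<lambda>s. \<psi> ?v (\<psi> ?u s))"
    unfolding is_rel_inverse_def fun_eq_iff comp_apply M 2
    by (metis idem_comm idem_phi_self idem_psi idem_psi_self)
  ultimately show ?thesis
    by (metis is_rel_inverse_unique)
qed

text \<open>As for the inverse of a bijective homomorphism; the idempotents that remain in the arguments
  of \<open>T\<close> are absorbed by the outer \<open>\<psi> d\<close>.\<close>

lemma psi_hom:
  assumes "\<phi> d \<in> shelf_Hom T"
  shows "T (\<psi> d a) (\<psi> d b) = \<psi> d (T a b)"
proof -
  have "T (\<psi> d a) (\<psi> d b) = \<psi> d (T (\<epsilon> d a) (\<epsilon> d b))"
  proof -
    have "T (\<psi> d a) (\<psi> d b) = \<psi> d (\<phi> d (T (\<psi> d a) (\<psi> d b)))"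
      by (simp add: psi_phi idem_T idem_psi_self)
    also have "\<dots> = \<psi> d (T (\<epsilon> d a) (\<epsilon> d b))"
      using assms by (simp add: shelf_Hom_def phi_psi)
    finally show ?thesis .
  qed
  also have "\<dots> = \<psi> d (\<epsilon> d (T (\<epsilon> d a) b))"
    by (simp add: idem_T)
  also have "\<dots> = \<psi> d (T a b)"
    by (simp only: idem_T_idem_left_arg psi_idem)
  finally show ?thesis .
qed

text \<open>Pulling the relative inverses out of both sides by \<open>psi_hom\<close> turns the equation into
  \<open>\<psi> w (\<psi> d A) = \<psi> v (\<psi> u B)\<close>, where \<open>A\<close> and \<open>B\<close> are the two sides of self-distributivity. The
  operators in front agree by \<open>psi_psi_eq\<close> and are injective on the fixed points of \<open>\<epsilon> u\<close>, among
  which are \<open>A\<close> and \<open>B\<close>.\<close>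

lemma last_braid_iff:
  assumes hom: "\<And>x. \<phi> x \<in> shelf_Hom T"
  shows "\<rho> z (\<rho> y x) = \<rho> (\<rho> z y) (\<rho> (\<phi> y z) x) \<longleftrightarrow>
    T (\<phi> x (\<phi> y z)) (T (\<phi> x y) x) =
    T (T (\<phi> x (\<phi> y z)) (\<phi> x y)) (T (\<phi> x (\<phi> y z)) x)"
proof -
  define d u w v where "d = \<phi> x y" and "u = \<phi> x (\<phi> y z)" and "w = \<phi> (\<rho> y x) z"
    and "v = \<rho> w d"
  have dw: "\<epsilon> d w = w"
    unfolding d_def w_def by (metis idem_rho idem_absorb idem_phi_self)
  have u: "\<phi> d w = u"
    unfolding d_def w_def u_def by (simp flip: braid)
  have w: "w = \<psi> d u"
    using dw u psi_phi by metis
  have eu: "\<epsilon> u s = \<epsilon> w s" for s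
    by (metis u idem_phi idem_absorb dw)
  have L: "\<rho> z (\<rho> y x) = \<psi> w (\<psi> d (T u (T d x)))"
  proof -
    have "\<rho> z (\<rho> y x) = \<psi> w (T w (\<psi> d (T d x)))"
      by (metis \<rho>_def d_def w_def)
    also have "T w (\<psi> d (T d x)) = \<psi> d (T u (T d x))"
      unfolding w by (rule psi_hom[OF hom])
    finally show ?thesis .
  qed
  have v: "\<phi> (\<rho> (\<phi> y z) x) (\<rho> z y) = v"
    using middle_braid_iff_hom hom unfolding v_def w_def d_def by metis
  have v': "v = \<psi> u (T u d)"
    unfolding v_def \<rho>_def u ..
  have "\<rho> (\<rho> z y) (\<rho> (\<phi> y z) x) = \<psi> v (T v (\<psi> u (T u x)))"
    unfolding \<rho>_def[of "\<rho> z y"] v by (simp add: \<rho>_def u_def)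
  also have "T v (\<psi> u (T u x)) = \<psi> u (T (T u d) (T u x))"
    unfolding v' by (rule psi_hom[OF hom])
  also have "\<psi> v (\<psi> u (T (T u d) (T u x))) = \<psi> w (\<psi> d (T (T u d) (T u x)))"
    unfolding v_def using psi_psi_eq[OF dw] u by simp
  finally have R: "\<rho> (\<rho> z y) (\<rho> (\<phi> y z) x) = \<psi> w (\<psi> d (T (T u d) (T u x)))" .
  have inj: "\<phi> d (\<phi> w (\<psi> w (\<psi> d s))) = \<epsilon> u s" for s
    by (metis dw idem_absorb eu phi_psi idem_comm idem_psi)
  have "\<epsilon> u (T u (T d x)) = T u (T d x)" "\<epsilon> u (T (T u d) (T u x)) = T (T u d) (T u x)"
    by (simp_all add: idem_left_T idem_T)
  then have "\<rho> z (\<rho> y x) = \<rho> (\<rho> z y) (\<rho> (\<phi> y z) x) \<longleftrightarrow> T u (T d x) = T (T u d) (T u x)"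
    unfolding L R by (metis inj)
  then show ?thesis by (simp add: d_def u_def)
qed

text \<open>The pointwise equivalence gives \<open>T u (T d x) = T (T u d) (T u x)\<close> for \<open>d\<close> in the image of
  \<open>\<phi> x\<close> and \<open>u\<close> in the image of \<open>\<phi> x \<circ> \<phi> (\<psi> x d)\<close>. Neither restriction matters, since no side
  changes when \<open>d\<close> is replaced by \<open>\<epsilon> x d\<close>, or, for such \<open>d\<close>, when \<open>u\<close> is replaced by
  \<open>\<epsilon> x (\<epsilon> d u)\<close>.\<close>

lemma last_braid_iff_shelf:
  assumes hom: "\<And>x. \<phi> x \<in> shelf_Hom T"
  shows "(\<forall>x y z. \<rho> z (\<rho> y x) = \<rho> (\<rho> z y) (\<rho> (\<phi> y z) x)) \<longleftrightarrow> left_shelf T"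
proof
  assume "\<forall>x y z. \<rho> z (\<rho> y x) = \<rho> (\<rho> z y) (\<rho> (\<phi> y z) x)"
  then have *: "T (\<phi> x (\<phi> y z)) (T (\<phi> x y) x) =
      T (T (\<phi> x (\<phi> y z)) (\<phi> x y)) (T (\<phi> x (\<phi> y z)) x)" for x y z
    by (simp only: last_braid_iff[OF hom])
  have fixed: "T u (T d x) = T (T u d) (T u x)" if d: "\<epsilon> x d = d" for u d x
  proof -
    define u' where "u' = \<epsilon> x (\<epsilon> d u)"
    have "\<phi> x (\<phi> (\<psi> x d) (\<psi> (\<psi> x d) (\<psi> x u))) = u'"
      unfolding u'_def by (metis phi_psi idem_of_psi idem_psi idem_comm idem_commute idem_absorb d)
    moreover have "\<phi> x (\<psi> x d) = d"
      by (simp add: phi_psi d)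
    ultimately have "T u' (T d x) = T (T u' d) (T u' x)"
      using *[of x "\<psi> x d" "\<psi> (\<psi> x d) (\<psi> x u)"] by simp
    moreover have "T u' (T d x) = T u (T d x)"
      unfolding u'_def by (simp add: T_idem_left_arg idem_left_T idem_right_T)
    moreover have "T u' d = T u d"
      unfolding u'_def by (metis T_idem_left_arg T_idem_right d)
    \<comment> \<open>Here \<open>T u' x\<close> and \<open>T u x\<close> themselves may differ, but their projections by \<open>\<epsilon> d\<close> agree.\<close>
    moreover have "T (T u d) (T u' x) = T (T u d) (T u x)"
    proof -
      have "\<epsilon> d (T (T u d) s) = T (T u d) s" for s
        by (metis idem_left_T idem_right_T idem_absorb)
      moreover have "\<epsilon> d (T u' x) = \<epsilon> d (T u x)"
        unfolding u'_def by (metis T_idem_right idem_T_idem_left_arg)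
      ultimately show ?thesis
        by (metis idem_T)
    qed
    ultimately show ?thesis by simp
  qed
  have "T u (T d x) = T (T u d) (T u x)" for u d x
  proof -
    have "T u (T d x) = T (T u (\<epsilon> x d)) (T u x)"
      by (metis T_idem_right fixed idem_idem)
    also have "\<dots> = T (T u d) (T u x)"
      by (metis idem_T T_idem_left_arg idem_right_T)
    finally show ?thesis .
  qed
  then show "left_shelf T" by (simp add: left_shelf_def)
next
  assume "left_shelf T"
  then show "\<forall>x y z. \<rho> z (\<rho> y x) = \<rho> (\<rho> z y) (\<rho> (\<phi> y z) x)"
    unfolding last_braid_iff[OF hom] left_shelf_def by blast
qed

end

section \<open>Twists and solutions\<close>

context shelf_twist
begin

lemma lam_r_of: "lam (r_of T \<phi>) = \<phi>"
  by (simp add: lam_def r_of_def fun_eq_iff)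

lemma rho_r_of: "rho (r_of T \<phi>) = \<rho>"
  by (simp add: rho_def r_of_def \<rho>_def fun_eq_iff)

lemma solution_r_of_iff:
  "solution (r_of T \<phi>) \<longleftrightarrow> left_shelf T \<and> (\<forall>a. \<phi> a \<in> shelf_Hom T) \<and>
     (\<forall>x y z. \<phi> x (\<phi> y z) = \<phi> (\<phi> x y) (\<phi> (\<rho> y x) z))"
proof (cases "\<forall>x y z. \<phi> x (\<phi> y z) = \<phi> (\<phi> x y) (\<phi> (\<rho> y x) z)")
  case True
  then interpret braided_shelf_twist \<phi> T
    by unfold_locales blast
  show ?thesis
    unfolding solution_iff_braid_equations lam_r_of rho_r_of middle_braid_iff_hom
    using last_braid_iff_shelf True by blast
next
  case False
  then show ?thesis
    unfolding solution_iff_braid_equations lam_r_of rho_r_of by blast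
qed

lemma g_twist_iff:
  "g_twist T \<phi> \<longleftrightarrow> (\<forall>a. \<phi> a \<in> shelf_Hom T) \<and>
     (\<forall>x y z. \<phi> x (\<phi> y z) = \<phi> (\<phi> x y) (\<phi> (\<rho> y x) z))"
  by (auto simp: g_twist_def fun_eq_iff has_inv idem_phi T_idem \<rho>_def intro: idem_T)

lemma quasi_left_nondegenerate_r_of: "quasi_left_nondegenerate (r_of T \<phi>)"
  by (simp add: quasi_left_nondegenerate_def lam_r_of has_inv fun_eq_iff idem_comm)

lemma star_identities_r_of:
  assumes "g_twist T \<phi>"
  shows "star_identities (r_of T \<phi>)"
proof -
  interpret braided_shelf_twist \<phi> T
    using assms unfolding g_twist_iff by unfold_locales blast
  show ?thesis
    by (auto simp: star_identities_def lam_r_of rho_r_of fun_eq_iff idem_phi rho_idem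
        idem_rho[unfolded idem_phi] intro: idem_rho_commute)
qed

end

text \<open>Write \<open>r (x, y) = (\<phi> x y, \<sigma> y x)\<close>. With \<open>u = \<phi> x y\<close>, the equation
  \<open>\<sigma> y x = \<psi> u (T u x)\<close> determines \<open>T u x\<close>, if fixed by \<open>\<epsilon> u\<close>, as \<open>\<phi> u (\<sigma> y x)\<close> for
  \<open>u\<close> in the image of \<open>\<phi> x\<close>. For other first arguments \<open>b\<close> the operation has to be extended by
  \<open>T b a = T (\<epsilon> a b) a\<close>, and \<open>\<epsilon> a b = \<phi> a (\<psi> a b)\<close> gives the formula for \<open>T\<close> below. The
  point to check is that \<open>T b\<close> commutes with the idempotents: an idempotent applied to the right
  argument also appears in the indices of \<open>\<phi>\<close> and \<open>\<psi>\<close>, where it turns into a projection of the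
  value.\<close>

lemma solution_is_r_of:
  fixes r :: "'a \<times> 'a \<Rightarrow> 'a \<times> 'a"
  assumes sol: "solution r" and qnd: "quasi_left_nondegenerate r" and star: "star_identities r"
  shows "\<exists>T \<phi>. left_shelf T \<and> g_twist T \<phi> \<and> r = r_of T \<phi>"
proof -
  define \<phi> where "\<phi> = lam r"
  define \<sigma> where "\<sigma> = rho r"
  interpret idempotent_family \<phi>
    using qnd star unfolding quasi_left_nondegenerate_def star_identities_def \<phi>_def
    by unfold_locales (auto simp: fun_eq_iff)
  have rho: "\<sigma> y x = \<epsilon> (\<phi> x y) (\<sigma> (\<epsilon> x y) x)" for x y
    using star unfolding star_identities_def \<phi>_def \<sigma>_def by blast
  have idem_rho_comm: "\<epsilon> x (\<sigma> y a) = \<sigma> y (\<epsilon> x a)" for x y a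
    using star unfolding star_identities_def \<phi>_def \<sigma>_def by (metis comp_apply)
  have braid: "\<phi> x (\<phi> y z) = \<phi> (\<phi> x y) (\<phi> (\<sigma> y x) z)" for x y z
    using sol unfolding solution_iff_braid_equations \<phi>_def \<sigma>_def by blast
  have rho_idem: "\<sigma> (\<epsilon> x y) x = \<sigma> y x" for x y
    by (metis rho phi_idem idem_idem)
  have phi_idem_arg: "\<phi> (\<epsilon> x b) z = \<epsilon> x (\<phi> b z)" for x b z
    using phi_of_idem[where \<rho> = \<sigma>, OF braid rho_idem] .
  have psi_idem_arg: "\<psi> (\<epsilon> x b) z = \<epsilon> x (\<psi> b z)" for x b z
    using psi_of_idem[OF phi_idem_arg] .
  have idem_rho_idem: "\<epsilon> x (\<sigma> (\<epsilon> x y) a) = \<epsilon> x (\<sigma> y a)" for x y a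
    by (metis idem_rho_comm rho_idem idem_of_idem idem_idem idem_commute)
  define T where "T b a = \<phi> (\<epsilon> a b) (\<sigma> (\<psi> a b) a)" for b a
  interpret shelf_twist \<phi> T
  proof
    fix a b x
    have "T b (\<epsilon> a x) = \<phi> (\<epsilon> a (\<epsilon> x b)) (\<sigma> (\<epsilon> a (\<psi> x b)) (\<epsilon> a x))"
      by (simp add: T_def psi_idem_arg idem_of_idem)
    also have "\<dots> = \<epsilon> a (\<phi> (\<epsilon> x b) (\<epsilon> a (\<sigma> (\<epsilon> a (\<psi> x b)) x)))"
      by (simp only: phi_idem_arg[of a "\<epsilon> x b"] idem_rho_comm)
    also have "\<dots> = \<epsilon> a (T b x)"
      by (metis T_def idem_rho_idem idem_comm idem_idem)
    finally show "\<epsilon> a (T b x) = T b (\<epsilon> a x)" by simp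
  next
    fix a b
    show "\<epsilon> (\<epsilon> a b) (T (\<epsilon> a b) a) = T b a"
      by (simp add: T_def idem_idem psi_idem idem_phi_self)
  qed
  have r: "r = r_of T \<phi>"
  proof
    fix p :: "'a \<times> 'a"
    obtain x y where p: "p = (x, y)" by fastforce
    have "\<psi> (\<phi> x y) (T (\<phi> x y) x) = \<sigma> y x"
      by (simp add: T_def idem_phi_self psi_phi flip: rho)
    moreover have "r (x, y) = (\<phi> x y, \<sigma> y x)"
      by (simp add: \<phi>_def \<sigma>_def lam_def rho_def)
    ultimately show "r p = r_of T \<phi> p"
      by (simp add: p r_of_def)
  qed
  then have "left_shelf T" "g_twist T \<phi>"
    using sol solution_r_of_iff g_twist_iff by simp_all
  with r show ?thesis by blast
qed

theorem theorem4p3: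
  shows "(\<forall>(T :: 'a \<Rightarrow> 'a \<Rightarrow> 'a) (\<phi> :: 'a \<Rightarrow> 'a \<Rightarrow> 'a).
            left_shelf T \<and>
            (\<forall>a. has_rel_inverse (\<phi> a)) \<and>
            (\<forall>a b. rel_idem (\<phi> a) \<circ> T b = T b \<circ> rel_idem (\<phi> a)) \<and>
            (\<forall>a b. rel_idem (\<phi> (\<phi> a b)) = rel_idem (\<phi> a) \<circ> rel_idem (\<phi> b)) \<and>
            (\<forall>a b. rel_idem (\<phi> (rel_idem (\<phi> a) b)) (T (rel_idem (\<phi> a) b) a) = T b a) \<longrightarrow>
            (solution (r_of T \<phi>) \<and> quasi_left_nondegenerate (r_of T \<phi>) \<and> star_identities (r_of T \<phi>)
              \<longleftrightarrow> g_twist T \<phi> \<and> (\<forall>a b. rel_idem (\<phi> a) \<circ> \<phi> b = \<phi> b \<circ> rel_idem (\<phi> a)))) \<and>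
         (\<forall>r :: 'a \<times> 'a \<Rightarrow> 'a \<times> 'a.
            solution r \<and> quasi_left_nondegenerate r \<and> star_identities r \<longrightarrow>
            (\<exists>T \<phi>. left_shelf T \<and> g_twist T \<phi> \<and> r = r_of T \<phi>))"
proof (intro conjI allI impI)
  fix T \<phi> :: "'a \<Rightarrow> 'a \<Rightarrow> 'a"
  assume hyps: "left_shelf T \<and>
            (\<forall>a. has_rel_inverse (\<phi> a)) \<and>
            (\<forall>a b. rel_idem (\<phi> a) \<circ> T b = T b \<circ> rel_idem (\<phi> a)) \<and>
            (\<forall>a b. rel_idem (\<phi> (\<phi> a b)) = rel_idem (\<phi> a) \<circ> rel_idem (\<phi> b)) \<and>
            (\<forall>a b. rel_idem (\<phi> (rel_idem (\<phi> a) b)) (T (rel_idem (\<phi> a) b) a) = T b a)"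
  have lam: "lam (r_of T \<phi>) = \<phi>"
    by (simp add: lam_def r_of_def fun_eq_iff)
  show "solution (r_of T \<phi>) \<and> quasi_left_nondegenerate (r_of T \<phi>) \<and> star_identities (r_of T \<phi>)
      \<longleftrightarrow> g_twist T \<phi> \<and> (\<forall>a b. rel_idem (\<phi> a) \<circ> \<phi> b = \<phi> b \<circ> rel_idem (\<phi> a))"
  proof (cases "\<forall>a b. rel_idem (\<phi> a) \<circ> \<phi> b = \<phi> b \<circ> rel_idem (\<phi> a)")
    case True
    interpret shelf_twist \<phi> T
      using hyps True by unfold_locales (auto simp: fun_eq_iff)
    show ?thesis
      using True hyps solution_r_of_iff g_twist_iff quasi_left_nondegenerate_r_of
        star_identities_r_of by blast
  next
    case False
    then show ?thesis
      unfolding quasi_left_nondegenerate_def lam by blast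
  qed
next
  fix r :: "'a \<times> 'a \<Rightarrow> 'a \<times> 'a"
  assume "solution r \<and> quasi_left_nondegenerate r \<and> star_identities r"
  then show "\<exists>T \<phi>. left_shelf T \<and> g_twist T \<phi> \<and> r = r_of T \<phi>"
    using solution_is_r_of by blast
qed

end
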